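(* Let $b\ge 3$ be an integer. Then $$\limsup_{n\to\infty}\frac{\nu_{1,b}(n)}{\log\log n}\le\frac{2}{\log(\alpha^{-1})},\qquad \alpha=\log_b(b-1).$$ Moreover, if Conjecture B (stated in the context) holds, then $$\limsup_{n\to\infty}\frac{\nu_{1,b}(n)}{\log\log n}\ge\frac{1}{\log(\beta^{-1})},\qquad \beta=\frac{\log_b 2}{2b}.$$ Here $\log$ is the natural logarithm.
   Context: For integers $t\ge 0$, $b\ge 2$, the $t$-shifted Sloane map in base $b$ is $S_{t,b}(n)=\prod_{i=0}^k (d_i+t)$, where $n=\sum_{i=0}^k d_ib^i$ is the base-$b$ expansion of $n$ ($0\le d_i\le b-1$, $d_k>0$). The persistence $\nu_{1,b}(n)$ is the smallest $k\ge0$ such that the $k$-th iterate $S_{1,b}^k(n)$ is a periodic point of $S_{1,b}$ (every positive integer reaches a periodic point under $S_{1,b}$, so this is finite). For a base $q$, a digit $d$ and a positive integer $n$, $\#d(n)_q$ is the number of occurrences of $d$ in the base-$q$ expansion of $n$ and $\#(n)_q$ the number of base-$q$ digits of $n$. Given $\varepsilon>0$, $n$ is $\varepsilon$-equidistributed in base $q$ if $\left|\frac{\#d(n)_q}{\#(n)_q}-\frac1q\right|<\varepsilon$ for every $d\in\{0,\dots,q-1\}$. Conjecture B: For every integer $q>1$, every finite set $F=\{p_1,\dots,p_k\}$ of primes that does not contain all primes dividing $q$, and every positive integer $a$, for every $\varepsilon>0$ there exists $N$ such that $a\prod_{i=1}^k p_i^{\alpha_i}$ (nonnegative integers $\alpha_i$)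 is $\varepsilon$-equidistributed in base $q$ whenever $\alpha_i\ge N$ for some $i$. *)

theory Defs
  imports "HOL-Analysis.Analysis" "HOL-Computational_Algebra.Primes"
begin

text \<open>Least significant digit first. The number 0 has the one-digit expansion \<open>[0]\<close>;
  the value for \<open>b < 2\<close> is irrelevant.\<close>

function digits :: "nat \<Rightarrow> nat \<Rightarrow> nat list" where
  "digits b n = (if b < 2 \<or> n < b then [n] else (n mod b) # digits b (n div b))"
  by auto
termination
  by (relation "Wellfounded.measure snd") auto

declare digits.simps [simp del]

lemma digits_not_Nil: "digits b n \<noteq> []"
  by (subst digits.simps) auto

lemma digits_expansion:
  assumes "b \<ge> 2"
  shows "horner_sum (\<lambda>d. d) b (digits b n) = n"
  using assms
proof (induction b n rule: digits.induct)
  case (1 b n)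
  show ?case
  proof (cases "n < b")
    case True
    then show ?thesis by (simp add: digits.simps[of b n])
  next
    case False
    with 1 have "horner_sum (\<lambda>d. d) b (digits b (n div b)) = n div b" by simp
    with False 1(2) show ?thesis by (simp add: digits.simps[of b n])
  qed
qed

lemma digits_less:
  assumes "b \<ge> 2" "d \<in> set (digits b n)"
  shows "d < b"
  using assms
proof (induction b n rule: digits.induct)
  case (1 b n)
  show ?case
  proof (cases "n < b")
    case True
    with 1(2,3) show ?thesis by (simp add: digits.simps[of b n])
  next
    case False
    with 1 show ?thesis by (auto simp: digits.simps[of b n])
  qed
qed

lemma last_digits_pos:
  assumes "b \<ge> 2" "n > 0"
  shows "last (digits b n) > 0"
  using assms
proof (induction b n rule: digits.induct)
  case (1 b n)
  show ?case
  proof (cases "n < b")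
    case True
    with 1(3) show ?thesis by (simp add: digits.simps[of b n])
  next
    case False
    with 1 have "last (digits b (n div b)) > 0" by (simp add: div_greater_zero_iff)
    with False 1(2) show ?thesis by (simp add: digits.simps[of b n] digits_not_Nil)
  qed
qed

definition sloane :: "nat \<Rightarrow> nat \<Rightarrow> nat \<Rightarrow> nat" where
  "sloane t b n = (\<Prod>d\<leftarrow>digits b n. d + t)"

definition periodic_point :: "('a \<Rightarrow> 'a) \<Rightarrow> 'a \<Rightarrow> bool" where
  "periodic_point f x \<longleftrightarrow> (\<exists>m>0. (f ^^ m) x = x)"

definition persistence :: "nat \<Rightarrow> nat \<Rightarrow> nat \<Rightarrow> nat" where
  "persistence t b n = (LEAST k. periodic_point (sloane t b) ((sloane t b ^^ k) n))"

text \<open>The minimum in \<^const>\<open>persistence\<close> is over a nonempty set when \<open>t = 1\<close>: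
  \<open>{..b ^ k}\<close> is mapped into itself.\<close>

lemma sloane_1_le:
  assumes "b \<ge> 2" "n < b ^ Suc k"
  shows "sloane 1 b n \<le> b ^ Suc k"
  using assms(2)
proof (induction k arbitrary: n)
  case 0
  with assms(1) show ?case by (simp add: sloane_def digits.simps[of b n])
next
  case (Suc k)
  show ?case
  proof (cases "n < b")
    case True
    have "n + 1 \<le> b ^ 1" using True by simp
    also have "\<dots> \<le> b ^ Suc (Suc k)" using assms(1) by (intro power_increasing) auto
    finally show ?thesis using True by (simp add: sloane_def digits.simps[of b n])
  next
    case False
    have "n div b < b ^ Suc k"
      using Suc.prems assms(1) by (simp add: less_mult_imp_div_less mult.commute)
    then have "sloane 1 b (n div b) \<le> b ^ Suc k" by (rule Suc.IH)
    moreover have "n mod b + 1 \<le> b"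
      using assms(1) by (simp add: Suc_leI)
    ultimately have "(n mod b + 1) * sloane 1 b (n div b) \<le> b * b ^ Suc k"
      by (rule mult_le_mono[rotated])
    then show ?thesis using False assms(1) by (simp add: sloane_def digits.simps[of b n])
  qed
qed

lemma sloane_1_power:
  assumes "b \<ge> 2"
  shows "sloane 1 b (b ^ k) = 2"
proof (induction k)
  case 0
  with assms show ?case by (simp add: sloane_def digits.simps[of b "Suc 0"])
next
  case (Suc k)
  have "\<not> b ^ Suc k < b" using assms by simp
  with Suc assms show ?case by (simp add: sloane_def digits.simps[of b "b * b ^ k"])
qed

lemma reaches_periodic_point:
  assumes "b \<ge> 2"
  shows "\<exists>k. periodic_point (sloane 1 b) ((sloane 1 b ^^ k) n)"
proof -
  let ?S = "sloane 1 b"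
  obtain K where K: "n < b ^ Suc K"
  proof
    show "n < b ^ Suc n"
      using assms less_exp[of "Suc n"] power_mono[of 2 b "Suc n"] by linarith
  qed
  have le: "(?S ^^ i) n \<le> b ^ Suc K" for i
  proof (induction i)
    case 0
    with K show ?case by simp
  next
    case (Suc i)
    have "2 \<le> b ^ Suc K" using assms self_le_power[of b "Suc K"] by linarith
    with Suc show ?case
      using sloane_1_le[OF assms, of "(?S ^^ i) n" K] sloane_1_power[OF assms, of "Suc K"]
      by (cases "(?S ^^ i) n = b ^ Suc K") (auto simp del: power_Suc)
  qed
  have "finite (range (\<lambda>i. (?S ^^ i) n))"
    by (rule finite_subset[of _ "{..b ^ Suc K}"]) (use le in auto)
  then have "\<not> inj (\<lambda>i. (?S ^^ i) n)"
    using finite_imageD infinite_UNIV_nat by blast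
  then obtain i j where ij: "i < j" "(?S ^^ i) n = (?S ^^ j) n"
    using linorder_injI[of "\<lambda>i. (?S ^^ i) n"] by blast
  have "(?S ^^ (j - i)) ((?S ^^ i) n) = (?S ^^ i) n"
    using ij(1) ij(2)[symmetric] by (simp flip: funpow_add[THEN fun_cong, unfolded comp_def])
  with ij(1) show ?thesis
    unfolding periodic_point_def by (meson zero_less_diff)
qed

definition equidistributed :: "real \<Rightarrow> nat \<Rightarrow> nat \<Rightarrow> bool" where
  "equidistributed \<epsilon> q n \<longleftrightarrow>
     (\<forall>d<q. \<bar>real (count_list (digits q n) d) / real (length (digits q n)) - 1 / real q\<bar> < \<epsilon>)"

definition conjecture_B :: bool where
  "conjecture_B \<longleftrightarrow>
     (\<forall>(q::nat) (F::nat set) (a::nat) (\<epsilon>::real).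
        q > 1 \<longrightarrow> finite F \<longrightarrow> (\<forall>p\<in>F. prime p) \<longrightarrow> \<not> {p. prime p \<and> p dvd q} \<subseteq> F \<longrightarrow>
        a > 0 \<longrightarrow> \<epsilon> > 0 \<longrightarrow>
        (\<exists>N. \<forall>e :: nat \<Rightarrow> nat. (\<exists>p\<in>F. e p \<ge> N) \<longrightarrow>
           equidistributed \<epsilon> q (a * (\<Prod>p\<in>F. p ^ e p))))"

end

theory Submission imports Defs begin

text \<open>
  Upper bound: each digit \<open>b - 1\<close> of \<open>n\<close> contributes a factor \<open>b\<close> to \<open>S n\<close>, i.e. a trailing zero,
  which the next step ignores. Hence, if \<open>n\<close> has \<open>L\<close> digits, \<open>S (S n) \<le> b * (b - 1) ^ L\<close>, so two
  steps contract \<open>ln n\<close> by the factor \<open>\<alpha>\<close> up to an additive constant. In particular the periodic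
  points are bounded.

  Lower bound: start at \<open>(b - 1) ^ e\<close> and strip trailing zeros after every step. The stripped numbers
  have only prime factors up to \<open>b\<close> and are not divisible by \<open>b\<close>, so Conjecture B makes them
  equidistributed as long as they are large. At least \<open>L / (2 * b)\<close> of the digits are then \<open>b - 2\<close>,
  and since \<open>b - 1\<close> is coprime to \<open>b\<close>, \<open>ln\<close> of the stripped number decreases by at most the factor
  \<open>\<beta>\<close>. No iterate that exceeds the bound on periodic points is periodic.
\<close>

subsection \<open>Digits and trailing zeros\<close>

text \<open>Digits are listed from the least significant one, so trailing zeros come first. At
  \<open>m = 0\<close> and \<open>r > 0\<close> this fails, since 0 has the one-digit expansion
  \<open>[0]\<close>.\<close>

lemma digits_power_mult:
  assumes "b \<ge> 2" "m > 0"
  shows "digits b (b ^ r * m) = replicate r 0 @ digits b m"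
proof (induction r)
  case (Suc r)
  have "b \<le> b * (b ^ r * m)" using assms by simp
  then show ?case using assms Suc by (simp add: digits.simps[of b "b * _"] mult.assoc)
qed simp

lemma sloane_1_power_mult:
  assumes "b \<ge> 2" "m > 0"
  shows "sloane 1 b (b ^ r * m) = sloane 1 b m"
  using digits_power_mult[OF assms, of r] by (simp add: sloane_def)

lemma less_power_length_digits:
  assumes "b \<ge> 2"
  shows "n < b ^ length (digits b n)"
  using assms
proof (induction b n rule: digits.induct)
  case (1 b n)
  show ?case
  proof (cases "n < b")
    case False
    with 1 have "n div b < b ^ length (digits b (n div b))" by simp
    then have "n < b ^ length (digits b (n div b)) * b"
      using 1(2) by (subst (asm) div_less_iff_less_mult) auto
    with False 1(2) show ?thesis by (simp add: digits.simps[of b n] mult.commute)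
  qed (simp add: digits.simps[of b n])
qed

lemma power_length_digits_le:
  assumes "b \<ge> 2" "n > 0"
  shows "b ^ length (digits b n) \<le> b * n"
  using assms
proof (induction b n rule: digits.induct)
  case (1 b n)
  show ?case
  proof (cases "n < b")
    case False
    with 1 have "b ^ length (digits b (n div b)) \<le> b * (n div b)"
      by (simp add: div_greater_zero_iff)
    also have "\<dots> \<le> n" by simp
    finally show ?thesis using False 1(2) by (simp add: digits.simps[of b n])
  qed (use 1 in \<open>simp add: digits.simps[of b n]\<close>)
qed

lemma sloane_1_pos: "sloane 1 b n > 0"
proof -
  have "(\<Prod>d\<leftarrow>ds. d + 1) > (0::nat)" for ds by (induction ds) auto
  then show ?thesis by (simp add: sloane_def)
qed

lemma sloane_1_le_mult:
  assumes "b \<ge> 2" "n > 0"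
  shows "sloane 1 b n \<le> b * n"
proof -
  obtain k where k: "length (digits b n) = Suc k"
    using digits_not_Nil[of b n] by (cases "digits b n") auto
  have "sloane 1 b n \<le> b ^ Suc k"
    using sloane_1_le[OF assms(1)] less_power_length_digits[OF assms(1), of n] k by metis
  also have "\<dots> \<le> b * n" using power_length_digits_le[OF assms] k by metis
  finally show ?thesis .
qed

text \<open>In the induction \<open>r\<close> counts the digits \<open>b - 1\<close>, whose factors
  are exactly \<open>b\<close>; every other factor is at most \<open>b - 1\<close>.\<close>

lemma prod_list_Suc_eq_power_mult:
  assumes "\<forall>d\<in>set ds. d < (b::nat)" "b \<ge> 2"
  shows "\<exists>r m. (\<Prod>d\<leftarrow>ds. d + 1) = b ^ r * m \<and> m \<le> (b - 1) ^ length ds"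
  using assms(1)
proof (induction ds)
  case Nil
  show ?case by (rule exI[of _ 0]) simp
next
  case (Cons d ds)
  then obtain r m where rm: "(\<Prod>d\<leftarrow>ds. d + 1) = b ^ r * m" "m \<le> (b - 1) ^ length ds"
    by auto
  show ?case
  proof (cases "d + 1 = b")
    case True
    have "m \<le> (b - 1) * (b - 1) ^ length ds"
      using mult_le_mono[of 1 "b - 1", OF _ rm(2)] assms(2) by simp
    moreover have "(\<Prod>d\<leftarrow>d # ds. d + 1) = b ^ Suc r * m" using rm(1) True by simp
    ultimately show ?thesis by (metis length_Cons power_Suc)
  next
    case False
    with Cons.prems have "d + 1 \<le> b - 1" by auto
    then have "(d + 1) * m \<le> (b - 1) * (b - 1) ^ length ds" using rm(2) by (rule mult_le_mono)
    moreover have "(\<Prod>d\<leftarrow>d # ds. d + 1) = b ^ r * ((d + 1) * m)"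
      using rm(1) by (simp add: algebra_simps)
    ultimately show ?thesis by (metis length_Cons power_Suc)
  qed
qed

subsection \<open>Two steps contract the logarithm\<close>

text \<open>The second step sees only the cofactor \<open>m\<close> of \<open>b ^ r\<close>, and one
  step multiplies a number by at most \<open>b\<close>.\<close>

lemma sloane_1_twice_le:
  assumes "b \<ge> 2"
  shows "sloane 1 b (sloane 1 b n) \<le> b * (b - 1) ^ length (digits b n)"
proof -
  obtain r m where rm: "sloane 1 b n = b ^ r * m" "m \<le> (b - 1) ^ length (digits b n)"
    using prod_list_Suc_eq_power_mult[of "digits b n" b] digits_less[OF assms] assms
    unfolding sloane_def by blast
  have m: "m > 0" using rm(1) sloane_1_pos[of b n] by (auto intro: Nat.gr0I)
  have "sloane 1 b (sloane 1 b n) = sloane 1 b m"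
    using sloane_1_power_mult[OF assms m] rm(1) by simp
  also have "\<dots> \<le> b * m" by (rule sloane_1_le_mult[OF assms m])
  also have "\<dots> \<le> b * (b - 1) ^ length (digits b n)" using rm(2) by simp
  finally show ?thesis .
qed

lemma length_digits_le:
  assumes "b \<ge> 2" "n > 0"
  shows "real (length (digits b n)) \<le> 1 + ln n / ln b"
proof -
  have "real (b ^ length (digits b n)) \<le> real (b * n)"
    using power_length_digits_le[OF assms] by (simp only: of_nat_le_iff)
  then have "ln (real b ^ length (digits b n)) \<le> ln (real b * real n)"
    using assms by (subst ln_le_cancel_iff) auto
  then have "real (length (digits b n)) * ln b \<le> ln b + ln n"
    using assms by (simp add: ln_realpow ln_mult)
  moreover have "ln (real b) > 0" using assms by simp
  ultimately show ?thesis by (simp add: field_simps)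
qed

lemma ln_less_length_digits:
  assumes "b \<ge> 2" "n > 0"
  shows "ln (real n) < real (length (digits b n)) * ln b"
proof -
  have "real n < real (b ^ length (digits b n))"
    using less_power_length_digits[OF assms(1), of n] by (simp only: of_nat_less_iff)
  then have "ln (real n) < ln (real b ^ length (digits b n))"
    using assms by (subst ln_less_cancel_iff) auto
  then show ?thesis using assms by (simp add: ln_realpow)
qed

lemma ln_sloane_1_twice_le:
  assumes "b \<ge> 3" "n > 0"
  shows "ln (real (sloane 1 b (sloane 1 b n)))
         \<le> log b (real b - 1) * ln n + (ln b + ln (real b - 1))"
proof -
  have b: "b \<ge> 2" using assms by simp
  let ?L = "length (digits b n)"
  have "real (sloane 1 b (sloane 1 b n)) \<le> real (b * (b - 1) ^ ?L)"
    using sloane_1_twice_le[OF b, of n] by (simp only: of_nat_le_iff)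
  also have "\<dots> = real b * (real b - 1) ^ ?L" using b by (simp add: of_nat_diff)
  finally have "ln (real (sloane 1 b (sloane 1 b n))) \<le> ln (real b * (real b - 1) ^ ?L)"
    using sloane_1_pos assms by (subst ln_le_cancel_iff) auto
  also have "\<dots> = ln b + ?L * ln (real b - 1)" using assms by (simp add: ln_mult ln_realpow)
  also have "\<dots> \<le> ln b + (1 + ln n / ln b) * ln (real b - 1)"
    using length_digits_le[OF b assms(2)] assms by (intro add_left_mono mult_right_mono) auto
  also have "\<dots> = log b (real b - 1) * ln n + (ln b + ln (real b - 1))"
    by (simp add: log_def field_simps)
  finally show ?thesis .
qed

lemma funpow_sloane_1_pos: "n > 0 \<Longrightarrow> (sloane 1 b ^^ k) n > 0"
  by (cases k) (auto simp: sloane_1_pos simp del: One_nat_def)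

lemma log_pred_bounds:
  assumes "(b::nat) \<ge> 3"
  shows "0 < log b (real b - 1)" "log b (real b - 1) < 1"
  using assms by (auto simp: log_less_one_cancel_iff zero_less_log_cancel_iff)

text \<open>The fixed point of the affine bound in \<open>ln_sloane_1_twice_le\<close>.\<close>

definition log_attractor :: "nat \<Rightarrow> real" where
  "log_attractor b = (ln b + ln (real b - 1)) / (1 - log b (real b - 1))"

text \<open>Centering the affine bound at its fixed point turns it into a pure contraction, which
  iterates to a geometric factor.\<close>

lemma ln_funpow_sloane_1_le:
  assumes "b \<ge> 3" "n > 0"
  shows "ln (real ((sloane 1 b ^^ (2 * k)) n)) - log_attractor b
         \<le> log b (real b - 1) ^ k * (ln n - log_attractor b)"
proof (induction k)
  case (Suc k)
  let ?S = "sloane 1 b" and ?\<alpha> = "log b (real b - 1)" and ?D = "log_attractor b"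
  let ?m = "(?S ^^ (2 * k)) n"
  have D: "ln b + ln (real b - 1) = ?D - ?\<alpha> * ?D"
  proof -
    have "?D * (1 - ?\<alpha>) = ln b + ln (real b - 1)"
      using log_pred_bounds[OF assms(1)] unfolding log_attractor_def by simp
    then show ?thesis by (simp add: algebra_simps)
  qed
  have "ln (real ((?S ^^ (2 * Suc k)) n)) \<le> ?\<alpha> * ln (real ?m) + (ln b + ln (real b - 1))"
    using ln_sloane_1_twice_le[OF assms(1) funpow_sloane_1_pos[OF assms(2)], of "2 * k" b]
    by simp
  then have "ln (real ((?S ^^ (2 * Suc k)) n)) - ?D \<le> ?\<alpha> * (ln (real ?m) - ?D)"
    unfolding D by (simp add: algebra_simps)
  also have "\<dots> \<le> ?\<alpha> * (?\<alpha> ^ k * (ln n - ?D))"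
    using Suc log_pred_bounds[OF assms(1)] by (intro mult_left_mono) auto
  finally show ?case by simp
qed simp

subsection \<open>Periodic points and persistence\<close>

lemma funpow_periodic: "(f ^^ m) x = x \<Longrightarrow> (f ^^ (k * m)) x = x"
  by (induction k) (simp_all add: funpow_add)

lemma periodic_point_funpow:
  assumes "periodic_point f x"
  shows "periodic_point f ((f ^^ k) x)"
proof -
  obtain m where m: "m > 0" "(f ^^ m) x = x" using assms by (auto simp: periodic_point_def)
  have "(f ^^ m) ((f ^^ k) x) = (f ^^ k) ((f ^^ m) x)"
    by (metis add.commute comp_apply funpow_add)
  with m show ?thesis unfolding periodic_point_def by metis
qed

text \<open>A point that returns after \<open>m\<close> steps also returns after
  \<open>2 * m\<close> steps, whereas \<open>m\<close> double steps would shrink a positive excess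
  over \<open>log_attractor b\<close> by the factor \<open>\<alpha> ^ m < 1\<close>.\<close>

lemma periodic_point_sloane_1_le:
  assumes "b \<ge> 3" "n > 0" "periodic_point (sloane 1 b) n"
  shows "ln (real n) \<le> log_attractor b"
proof (rule ccontr)
  let ?\<alpha> = "log b (real b - 1)"
  assume "\<not> ?thesis"
  then have y: "ln n - log_attractor b > 0" by simp
  obtain m where m: "m > 0" "(sloane 1 b ^^ m) n = n"
    using assms(3) by (auto simp: periodic_point_def)
  have "ln n - log_attractor b \<le> ?\<alpha> ^ m * (ln n - log_attractor b)"
    using ln_funpow_sloane_1_le[OF assms(1,2), of m] funpow_periodic[OF m(2), of 2] by simp
  then have "1 \<le> ?\<alpha> ^ m" using y by simp
  moreover have "?\<alpha> ^ m < 1"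
    using m(1) log_pred_bounds[OF assms(1)] by (simp add: power_less_one_iff)
  ultimately show False by simp
qed

lemma periodic_point_persistence:
  assumes "b \<ge> 2"
  shows "periodic_point (sloane 1 b) ((sloane 1 b ^^ persistence 1 b n) n)"
  unfolding persistence_def by (rule LeastI_ex) (rule reaches_periodic_point[OF assms])

text \<open>Allows the persistence to be estimated from any later point of the orbit.\<close>

lemma persistence_le_add:
  assumes "b \<ge> 2"
  shows "persistence 1 b n \<le> persistence 1 b ((sloane 1 b ^^ j) n) + j"
  unfolding persistence_def[of _ _ n]
  using periodic_point_persistence[OF assms, of "(sloane 1 b ^^ j) n"]
  by (intro Least_le) (simp add: funpow_add)

text \<open>Once the orbit has reached a periodic point, all later iterates are periodic and hence
  bounded.\<close>

lemma less_persistence: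
  assumes "b \<ge> 3" "n > 0" "ln (real ((sloane 1 b ^^ k) n)) > log_attractor b"
  shows "k < persistence 1 b n"
proof (rule ccontr)
  let ?S = "sloane 1 b" and ?p = "persistence 1 b n"
  assume "\<not> ?thesis"
  then have "(?S ^^ k) n = (?S ^^ (k - ?p)) ((?S ^^ ?p) n)"
    by (metis add.commute comp_apply funpow_add le_add_diff_inverse not_less)
  then have "periodic_point ?S ((?S ^^ k) n)"
    using periodic_point_funpow periodic_point_persistence[of b n] assms(1) by simp
  with periodic_point_sloane_1_le[OF assms(1) funpow_sloane_1_pos[OF assms(2)]] assms(3)
  show False by fastforce
qed

subsection \<open>The upper bound\<close>

text \<open>About \<open>ln (ln n) / ln (1 / \<alpha>)\<close> double steps bring the orbit into a
  finite set independent of \<open>n\<close>, on which the persistence is bounded.\<close>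

lemma persistence_upper_bound:
  assumes "b \<ge> 3"
  shows "\<exists>K. \<forall>n::nat. ln (real n) \<ge> 1 \<longrightarrow>
    real (persistence 1 b n) \<le> 2 / ln (inverse (log b (real b - 1))) * ln (ln (real n)) + K"
proof -
  define \<alpha> where "\<alpha> = log b (real b - 1)"
  have \<alpha>: "0 < \<alpha>" "\<alpha> < 1" using log_pred_bounds[OF assms] by (auto simp: \<alpha>_def)
  define l where "l = ln (inverse \<alpha>)"
  have l: "l > 0" "ln \<alpha> = - l" using \<alpha> by (auto simp: l_def ln_inverse)
  \<comment> \<open>The maximum with 0 lets \<open>(1 - \<alpha> ^ k) * log_attractor b\<close> be
    bounded by \<open>D\<close> without a sign argument.\<close>
  define D where "D = max 0 (log_attractor b)"
  define K where "K = Max (persistence 1 b ` {..nat \<lfloor>exp (D + 1)\<rfloor>})"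
  have "real (persistence 1 b n) \<le> 2 / l * ln (ln n) + (2 + K)" if n: "ln (real n) \<ge> 1" for n
  proof -
    have n0: "n > 0" using n by (auto intro: Nat.gr0I)
    define x where "x = ln (real n)"
    \<comment> \<open>The least \<open>k\<close> with \<open>\<alpha> ^ k * x \<le> 1\<close>.
      Rounding up costs at most one double step, hence the 2 in the constant.\<close>
    define k where "k = nat \<lceil>ln x / l\<rceil>"
    have x: "x \<ge> 1" using n by (simp add: x_def)
    have k: "ln x / l \<le> k" "real k \<le> ln x / l + 1"
      using x l by (auto simp: k_def)
    have "\<alpha> ^ k * x = exp (ln x - k * l)"
      using \<alpha> x l by (simp add: exp_diff exp_minus field_simps exp_of_nat_mult l_def)
    also have "\<dots> \<le> 1" using k(1) l by (simp add: field_simps)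
    finally have kx: "\<alpha> ^ k * x \<le> 1" .
    let ?m = "(sloane 1 b ^^ (2 * k)) n"
    have "\<alpha> ^ k \<le> 1" using \<alpha> by (simp add: power_le_one)
    then have "(1 - \<alpha> ^ k) * log_attractor b \<le> 1 * D"
      using \<alpha> by (intro order.trans[OF mult_left_mono mult_right_mono, of _ D]) (auto simp: D_def)
    then have "ln (real ?m) \<le> D + 1"
      using ln_funpow_sloane_1_le[OF assms n0, of k] kx
      unfolding \<alpha>_def[symmetric] x_def by (simp add: algebra_simps)
    then have "real ?m \<le> exp (D + 1)"
      using funpow_sloane_1_pos[OF n0, where k="2*k" and b=b]
      by (metis exp_le_cancel_iff exp_ln of_nat_0_less_iff)
    then have "?m \<le> nat \<lfloor>exp (D + 1)\<rfloor>" by (simp add: le_nat_floor)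
    then have "persistence 1 b ?m \<le> K" unfolding K_def by (intro Max_ge) auto
    then have "persistence 1 b n \<le> K + 2 * k"
      using persistence_le_add[of b n "2 * k"] assms by simp
    then have "real (persistence 1 b n) \<le> K + 2 * real k" by (simp flip: of_nat_le_iff)
    also have "\<dots> \<le> K + 2 * (ln x / l + 1)" using k by simp
    finally show ?thesis by (simp add: x_def)
  qed
  then show ?thesis unfolding l_def \<alpha>_def by blast
qed

lemma filterlim_ln_ln_sequentially: "filterlim (\<lambda>n. ln (ln (real n))) at_top sequentially"
  by (intro filterlim_compose[OF ln_at_top] filterlim_real_sequentially)

lemma limsup_persistence_le:
  assumes "b \<ge> 3"
  shows "limsup (\<lambda>n. ereal (real (persistence 1 b n) / ln (ln (real n))))
         \<le> ereal (2 / ln (inverse (log b (real b - 1))))"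
proof -
  define C where "C = 2 / ln (inverse (log b (real b - 1)))"
  obtain K where K: "\<And>n. ln (real n) \<ge> 1 \<Longrightarrow> real (persistence 1 b n) \<le> C * ln (ln (real n)) + K"
    using persistence_upper_bound[OF assms] unfolding C_def by blast
  have "(\<lambda>n. C + K / ln (ln (real n))) \<longlonglongrightarrow> C + 0"
    by (intro tendsto_add tendsto_const real_tendsto_divide_at_top[OF tendsto_const]
        filterlim_ln_ln_sequentially)
  then have lim: "(\<lambda>n. ereal (C + K / ln (ln (real n)))) \<longlonglongrightarrow> ereal C" by simp
  have "\<forall>\<^sub>F n in sequentially. ln (real n) \<ge> 1"
    using filterlim_compose[OF ln_at_top filterlim_real_sequentially]
    by (simp add: filterlim_at_top)
  moreover have "\<forall>\<^sub>F n in sequentially. ln (ln (real n)) > 0"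
    using filterlim_ln_ln_sequentially by (simp add: filterlim_at_top_dense)
  ultimately have "\<forall>\<^sub>F n in sequentially. ereal (real (persistence 1 b n) / ln (ln (real n)))
       \<le> ereal (C + K / ln (ln (real n)))"
  proof eventually_elim
    case (elim n)
    with K[of n] show ?case by (simp add: field_simps)
  qed
  then have "limsup (\<lambda>n. ereal (real (persistence 1 b n) / ln (ln (real n))))
       \<le> limsup (\<lambda>n. ereal (C + K / ln (ln (real n))))"
    by (rule Limsup_mono)
  also have "\<dots> = ereal C" by (rule lim_imp_Limsup[OF _ lim]) simp
  finally show ?thesis by (simp add: C_def)
qed

subsection \<open>The lower bound\<close>

text \<open>A prime dividing the product divides some factor \<open>d + 1\<close> with
  \<open>d < b\<close>. This keeps the primes of the iteration in a fixed finite set, as Conjecture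
  B requires.\<close>

lemma prime_dvd_sloane_1_le:
  assumes "b \<ge> 2" "prime p" "p dvd sloane 1 b n"
  shows "p \<le> b"
proof -
  have "\<exists>d\<in>set ds. p dvd d + 1" if "p dvd (\<Prod>d\<leftarrow>ds. d + 1)" for ds
    using that
  proof (induction ds)
    case Nil
    with assms(2) show ?case by simp
  next
    case (Cons d ds)
    then show ?case using prime_dvd_mult_iff[OF assms(2), of "d + 1" "\<Prod>d\<leftarrow>ds. d + 1"] by auto
  qed
  then obtain d where "d \<in> set (digits b n)" "p dvd d + 1"
    using assms(3) unfolding sloane_def by blast
  then show ?thesis using digits_less[OF assms(1)] dvd_imp_le[of p "d + 1"] by fastforce
qed

lemma power_count_dvd_sloane_1: "(d + 1) ^ count_list (digits b n) d dvd sloane 1 b n"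
proof -
  have "(d + 1) ^ count_list ds d dvd (\<Prod>d\<leftarrow>ds. d + 1)" for ds
    by (induction ds) (auto simp del: mult_Suc intro: mult_dvd_mono dvd_mult)
  then show ?thesis by (simp add: sloane_def)
qed

text \<open>If \<open>b\<close> does not divide \<open>m\<close>, then some prime \<open>p\<close> dividing \<open>b\<close> occurs in \<open>m\<close> with one of
  finitely many exponents, so \<open>p\<close> can be moved from \<open>F\<close> into the factor \<open>a\<close> of Conjecture B.\<close>

lemma conjecture_B_smooth:
  assumes "conjecture_B" "b \<ge> 2" "\<epsilon> > 0"
  shows "\<exists>N. \<forall>m p. m > 0 \<longrightarrow> \<not> b dvd m \<longrightarrow> (\<forall>q. prime q \<longrightarrow> q dvd m \<longrightarrow> q \<le> b) \<longrightarrow>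
      prime p \<longrightarrow> p \<le> b \<longrightarrow> \<not> p dvd b \<longrightarrow> p ^ N dvd m \<longrightarrow> equidistributed \<epsilon> b m"
proof -
  define P where "P = {p. prime p \<and> p \<le> b}"
  have finP: "finite P" unfolding P_def by (rule finite_subset[of _ "{..b}"]) auto
  \<comment> \<open>Conjecture B with prime set \<open>P - {p}\<close>, which omits the divisor
    \<open>p\<close> of \<open>b\<close>, and with constant \<open>p ^ j\<close>.\<close>
  have "\<exists>N. \<forall>e. (\<exists>q\<in>P - {p}. e q \<ge> N) \<longrightarrow>
           equidistributed \<epsilon> b (p ^ j * (\<Prod>q\<in>P - {p}. q ^ e q))"
    if "prime p" "p dvd b" for p j
  proof -
    have "b > 1" "finite (P - {p})" "\<forall>q\<in>P - {p}. prime q" "\<not> {q. prime q \<and> q dvd b} \<subseteq> P - {p}"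
      "p ^ j > 0"
      using assms(2) finP that by (auto simp: P_def prime_gt_0_nat)
    with assms(1,3) show ?thesis unfolding conjecture_B_def by blast
  qed
  then obtain f where f: "\<And>p j e q. \<lbrakk>prime p; p dvd b; q \<in> P - {p}; e q \<ge> f p j\<rbrakk> \<Longrightarrow>
        equidistributed \<epsilon> b (p ^ j * (\<Prod>q\<in>P - {p}. q ^ e q))"
    by metis
  \<comment> \<open>Only exponents below that of \<open>p\<close> in \<open>b\<close> will occur, so
    finitely many thresholds need a common bound.\<close>
  define I where "I = (SIGMA p:P. {..<multiplicity p b})"
  define N where "N = Max (insert 0 ((\<lambda>(p, j). f p j) ` I))"
  have N: "f p j \<le> N" if "p \<in> P" "j < multiplicity p b" for p j
    unfolding N_def using finP that by (intro Max_ge) (auto simp: I_def intro!: rev_image_eqI)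
  show ?thesis
  proof (intro exI[of _ N] allI impI)
    fix m p
    assume m: "m > 0" "\<not> b dvd m" and smooth: "\<forall>q. prime q \<longrightarrow> q dvd m \<longrightarrow> q \<le> b"
      and p: "prime p" "p \<le> b" "\<not> p dvd b" "p ^ N dvd m"
    obtain q where q: "prime q" "multiplicity q m < multiplicity q b"
    proof -
      have "b \<noteq> 0" using assms(2) by simp
      then have "\<exists>q. prime q \<and> \<not> multiplicity q b \<le> multiplicity q m"
        using multiplicity_le_imp_dvd m(2) by blast
      then show thesis using that by (auto simp: not_le)
    qed
    have qb: "q dvd b" using q(2) not_dvd_imp_multiplicity_0[of q b] by fastforce
    have qP: "q \<in> P" using q(1) qb assms(2) by (auto simp: P_def intro: dvd_imp_le)
    have "m = (\<Prod>q\<in>prime_factors m. q ^ multiplicity q m)"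
      using m(1) by (rule prime_factorization_nat)
    also have "\<dots> = (\<Prod>q\<in>P. q ^ multiplicity q m)"
      using finP smooth m(1)
      by (intro prod.mono_neutral_left)
        (auto simp: P_def prime_factors_dvd not_dvd_imp_multiplicity_0)
    also have "\<dots> = q ^ multiplicity q m * (\<Prod>r\<in>P - {q}. r ^ multiplicity r m)"
      using finP qP by (rule prod.remove)
    finally have eq: "m = q ^ multiplicity q m * (\<Prod>r\<in>P - {q}. r ^ multiplicity r m)" .
    \<comment> \<open>\<open>q\<close> divides \<open>b\<close> and \<open>p\<close> does not, so
      the large exponent of \<open>p\<close> is among the free exponents.\<close>
    have "p \<in> P - {q}" using p qb by (auto simp: P_def)
    moreover have "f q (multiplicity q m) \<le> multiplicity p m"
    proof -
      have "N \<le> multiplicity p m" using p m(1) by (intro multiplicity_geI) auto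
      with N[OF qP q(2)] show ?thesis by linarith
    qed
    ultimately show "equidistributed \<epsilon> b m"
      using f[OF q(1) qb, where q=p and e="\<lambda>r. multiplicity r m"
          and j="multiplicity q m"] eq by simp
  qed
qed

text \<open>The tolerance is half the expected frequency \<open>1 / b\<close>, so each digit keeps
  more than half of its expected share.\<close>

lemma count_digit_gt:
  assumes "equidistributed (1 / (2 * real b)) b m" "d < b"
  shows "real (length (digits b m)) / (2 * real b) < real (count_list (digits b m) d)"
proof -
  let ?c = "real (count_list (digits b m) d)" and ?L = "real (length (digits b m))"
  have L: "?L > 0" using digits_not_Nil by simp
  have "\<bar>?c / ?L - 1 / real b\<bar> < 1 / (2 * real b)"
    using assms by (simp add: equidistributed_def)
  then have "1 / real b - 1 / (2 * real b) < ?c / ?L" by linarith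
  then have "1 / (2 * real b) < ?c / ?L" by simp
  then show ?thesis using L by (simp add: field_simps)
qed

text \<open>Only the digits \<open>b - 2\<close> are used: they contribute powers of \<open>b - 1\<close>, which survive
  removing the trailing zeros.\<close>

lemma ln_sloane_1_ge:
  fixes b :: nat and \<beta> :: real
  defines "\<beta> \<equiv> log b 2 / (2 * real b)"
  assumes b: "b \<ge> 3" and m: "m > 0"
    and equi: "equidistributed (1 / (2 * real b)) b m"
    and large: "ln (real m) \<ge> 2 * real b * real N * ln b"
  obtains r m' where "sloane 1 b m = b ^ r * m'" "m' > 0" "\<not> b dvd m'"
    "\<forall>q. prime q \<longrightarrow> q dvd m' \<longrightarrow> q \<le> b" "(b - 1) ^ N dvd m'" "ln (real m') \<ge> \<beta> * ln m"
proof -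
  let ?L = "real (length (digits b m))"
  define c where "c = count_list (digits b m) (b - 2)"
  have c: "?L / (2 * real b) < c" unfolding c_def using b by (intro count_digit_gt[OF equi]) auto
  have lnb: "ln (real b) > 0" using b by simp
  have L: "ln (real m) < ?L * ln b" using b m by (intro ln_less_length_digits) auto
  \<comment> \<open>The size of \<open>m\<close> forces \<open>c \<ge> N\<close>. This reproduces
    the divisibility by \<open>(b - 1) ^ N\<close> for \<open>m'\<close>, so that the step can be
    repeated.\<close>
  with large have "2 * real b * real N * ln b < ?L * ln b" by linarith
  then have "2 * real b * real N < ?L" using lnb by simp
  then have "real N < ?L / (2 * real b)" using b by (simp add: field_simps)
  with c have Nc: "N \<le> c" by linarith
  have "sloane 1 b m \<noteq> 0" "\<not> is_unit b" using sloane_1_pos[of b m] b by auto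
  then obtain m' where m': "sloane 1 b m = b ^ multiplicity b (sloane 1 b m) * m'" "\<not> b dvd m'"
    by (rule multiplicity_decompose')
  define r where "r = multiplicity b (sloane 1 b m)"
  have eq: "sloane 1 b m = b ^ r * m'" using m'(1) by (simp add: r_def)
  have pos: "m' > 0" using m'(2) by (auto intro: Nat.gr0I)
  have "coprime (b - 1) b" using b by (intro coprime_diff_one_left_nat) simp
  then have "coprime ((b - 1) ^ c) (b ^ r)" by simp
  moreover have "b - 2 + 1 = b - 1" using b by simp
  then have "(b - 1) ^ c dvd b ^ r * m'"
    using power_count_dvd_sloane_1[of "b - 2" b m] eq unfolding c_def by simp
  ultimately have dvd: "(b - 1) ^ c dvd m'" by (simp add: coprime_dvd_mult_right_iff)
  \<comment> \<open>Origin of \<beta>: more than \<open>log b m / (2 * b)\<close> digits equal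
    \<open>b - 2\<close>, and each gives a factor \<open>b - 1 \<ge> 2\<close>.\<close>
  have "\<beta> * ln m = ln 2 * ((ln m / ln b) / (2 * real b))" by (simp add: \<beta>_def log_def)
  also have "\<dots> \<le> ln 2 * (?L / (2 * real b))"
    using L lnb by (intro mult_left_mono divide_right_mono) (auto simp: field_simps)
  also have "\<dots> \<le> ln 2 * c" using c by (intro mult_left_mono) auto
  also have "\<dots> = ln (2 ^ c)" by (simp add: ln_realpow)
  also have "2 ^ c \<le> m'"
    using dvd_imp_le[OF dvd pos] power_mono[of 2 "b - 1" c] b by linarith
  then have "ln (2 ^ c) \<le> ln (real m')"
    by (subst ln_le_cancel_iff) (use pos in \<open>auto simp flip: of_nat_le_iff\<close>)
  finally have "ln (real m') \<ge> \<beta> * ln m" .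
  moreover have "(b - 1) ^ N dvd m'" using Nc dvd le_imp_power_dvd dvd_trans by blast
  moreover have "q \<le> b" if "prime q" "q dvd m'" for q
    using prime_dvd_sloane_1_le[of b q m] b that eq by simp
  ultimately show thesis by (intro that[OF eq pos m'(2)]) auto
qed

lemma beta_bounds:
  assumes "(b::nat) \<ge> 3"
  shows "0 < log b 2 / (2 * real b)" "log b 2 / (2 * real b) < 1"
proof -
  have "0 < log b 2" "log b 2 < 1" using assms by auto
  moreover from this have "log b 2 < 2 * real b" using assms by linarith
  ultimately show "0 < log b 2 / (2 * real b)" "log b 2 / (2 * real b) < 1"
    using assms by (simp_all del: log_less_one_cancel_iff)
qed

text \<open>For \<open>n = (b - 1) ^ e\<close> the iterates stay above the bound on periodic points
  for about \<open>ln (ln n) / ln (1 / \<beta>)\<close> steps.\<close>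

lemma persistence_lower_bound:
  assumes "conjecture_B" "b \<ge> 3"
  obtains N K where "\<And>e. e \<ge> N \<Longrightarrow>
    real (persistence 1 b ((b - 1) ^ e))
      \<ge> 1 / ln (inverse (log b 2 / (2 * real b))) * ln (ln (real ((b - 1) ^ e))) - K"
proof -
  define \<beta> where "\<beta> = log b 2 / (2 * real b)"
  have \<beta>: "0 < \<beta>" "\<beta> < 1" using beta_bounds[OF assms(2)] by (auto simp: \<beta>_def)
  define l where "l = ln (inverse \<beta>)"
  have l: "l > 0" "ln \<beta> = - l" using \<beta> by (auto simp: l_def ln_inverse)
  have b2: "b \<ge> 2" using assms(2) by simp
  \<comment> \<open>The prime whose exponent stays large: \<open>(b - 1) ^ N dvd m\<close> gives
    \<open>p ^ N dvd m\<close>, as equidistribution of \<open>m\<close> requires.\<close>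
  obtain p where p: "prime p" "p dvd b - 1" using prime_factor_nat[of "b - 1"] assms(2) by fastforce
  have cop: "coprime (b - 1) b" using b2 by (intro coprime_diff_one_left_nat) simp
  have pb: "\<not> p dvd b" using coprime_common_divisor_nat[OF cop p(2)] p(1) by auto
  have ple: "p \<le> b" using dvd_imp_le[OF p(2)] assms(2) by simp
  have "1 / (2 * real b) > 0" using b2 by simp
  from conjecture_B_smooth[OF assms(1) b2 this] obtain N where N:
    "\<forall>m p. m > 0 \<longrightarrow> \<not> b dvd m \<longrightarrow> (\<forall>q. prime q \<longrightarrow> q dvd m \<longrightarrow> q \<le> b) \<longrightarrow>
      prime p \<longrightarrow> p \<le> b \<longrightarrow> \<not> p dvd b \<longrightarrow> p ^ N dvd m \<longrightarrow> equidistributed (1 / (2 * real b)) b m" ..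
  \<comment> \<open>Above \<open>T\<close>, \<open>ln_sloane_1_ge\<close> applies and no point is
    periodic; the \<open>+ 1\<close> makes the latter bound strict. \<open>T \<ge> 1\<close>
    provides positivity.\<close>
  define T where "T = Max {1, 2 * real b * real N * ln b, log_attractor b + 1}"
  have T: "T \<ge> 1" "T \<ge> 2 * real b * real N * ln b" "T > log_attractor b"
    unfolding T_def by (auto simp: less_max_iff_disj)
  \<comment> \<open>Invariant of the stripped iterates: what equidistribution and the next
    application of \<open>ln_sloane_1_ge\<close> need.\<close>
  have iter: "\<exists>r m. (sloane 1 b ^^ i) ((b - 1) ^ e) = b ^ r * m \<and> m > 0 \<and> \<not> b dvd m \<and>
      (\<forall>q. prime q \<longrightarrow> q dvd m \<longrightarrow> q \<le> b) \<and> (b - 1) ^ N dvd m \<and> ln (real m) \<ge> \<beta> ^ i * x"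
    if e: "e \<ge> N" and x: "x = ln (real ((b - 1) ^ e))" and "\<beta> ^ i * x \<ge> T" for i e x
    using that(3)
  proof (induction i)
    case 0
    have "coprime ((b - 1) ^ e) b" using cop by simp
    then have "\<not> b dvd (b - 1) ^ e" using coprime_common_divisor_nat[of _ b b] b2 by force
    moreover have "q \<le> b" if "prime q" "q dvd (b - 1) ^ e" for q
      using prime_dvd_power[OF that] dvd_imp_le[of q "b - 1"] assms(2) by simp
    moreover have "(b - 1) ^ N dvd (b - 1) ^ e" using e by (rule le_imp_power_dvd)
    ultimately show ?case
      using assms(2) x by (intro exI[of _ 0] exI[of _ "(b - 1) ^ e"]) auto
  next
    case (Suc i)
    have "\<beta> ^ Suc i * x \<ge> T" by (rule Suc.prems)
    \<comment> \<open>As \<open>\<beta> < 1\<close>, the size condition at \<open>Suc i\<close>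
      implies the one at \<open>i\<close>, so the induction hypothesis applies.\<close>
    then have "\<beta> ^ i * x \<ge> T / \<beta>" using \<beta> by (simp add: field_simps)
    moreover have "T / \<beta> \<ge> T" using \<beta> T(1) by (simp add: field_simps)
    ultimately have Ti: "\<beta> ^ i * x \<ge> T" by simp
    with Suc.IH obtain r m where IH: "(sloane 1 b ^^ i) ((b - 1) ^ e) = b ^ r * m" "m > 0"
      "\<not> b dvd m" "\<forall>q. prime q \<longrightarrow> q dvd m \<longrightarrow> q \<le> b" "(b - 1) ^ N dvd m"
      "ln (real m) \<ge> \<beta> ^ i * x" by blast
    have "p ^ N dvd m" using p(2) IH(5) dvd_power_same dvd_trans by blast
    then have equi: "equidistributed (1 / (2 * real b)) b m"
      using N IH(2,3,4) p(1) ple pb by blast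
    have large: "ln (real m) \<ge> 2 * real b * real N * ln b" using IH(6) Ti T(2) by linarith
    obtain r' m' where m': "sloane 1 b m = b ^ r' * m'" "m' > 0" "\<not> b dvd m'"
      "\<forall>q. prime q \<longrightarrow> q dvd m' \<longrightarrow> q \<le> b" "(b - 1) ^ N dvd m'" "ln (real m') \<ge> \<beta> * ln m"
      by (rule ln_sloane_1_ge[OF assms(2) IH(2) equi large, folded \<beta>_def])
    have "\<beta> ^ Suc i * x \<le> \<beta> * ln m" using IH(6) \<beta> by (simp add: mult.assoc)
    with m'(6) have "\<beta> ^ Suc i * x \<le> ln m'" by linarith
    moreover have "(sloane 1 b ^^ Suc i) ((b - 1) ^ e) = b ^ r' * m'"
      using IH(1) m'(1) sloane_1_power_mult[OF b2 IH(2)] by simp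
    ultimately show ?case using m' by blast
  qed
  have bound: "real (persistence 1 b ((b - 1) ^ e))
      \<ge> 1 / l * ln (ln (real ((b - 1) ^ e))) - (ln T / l + 1)"
    if e: "e \<ge> N" and x: "x = ln (real ((b - 1) ^ e))" "x \<ge> T" for e x
  proof -
    \<comment> \<open>The largest \<open>k\<close> with \<open>\<beta> ^ k * x \<ge> T\<close>;
      rounding down loses at most 1, absorbed in the constant.\<close>
    define k where "k = nat \<lfloor>ln (x / T) / l\<rfloor>"
    have x0: "x > 0" "x / T \<ge> 1" using x(2) T(1) by auto
    then have "ln (x / T) / l \<ge> 0" using l by simp
    then have k: "k \<le> ln (x / T) / l" "ln (x / T) / l - 1 \<le> k"
      unfolding k_def by linarith+
    have "T = x * exp (- ln (x / T))" using x0 T(1) by (simp add: exp_minus)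
    also have "\<dots> \<le> x * exp (- (k * l))" using x0 k(1) l by (simp add: field_simps)
    also have "exp (- (k * l)) = \<beta> ^ k"
      using \<beta> l by (simp add: exp_minus exp_of_nat_mult l_def power_inverse)
    finally have "\<beta> ^ k * x \<ge> T" by (simp add: mult.commute)
    from iter[OF e x(1) this] obtain r m where m: "(sloane 1 b ^^ k) ((b - 1) ^ e) = b ^ r * m"
      "m > 0" "ln (real m) \<ge> \<beta> ^ k * x" by blast
    \<comment> \<open>Restoring the stripped zeros does not decrease the number, so the bound for
      \<open>m\<close> carries over to the actual iterate.\<close>
    have "m \<le> b ^ r * m" using b2 by simp
    then have "ln (real m) \<le> ln (real ((sloane 1 b ^^ k) ((b - 1) ^ e)))"
      unfolding m(1) using m(2) b2 by (subst ln_le_cancel_iff) (auto simp flip: of_nat_mult of_nat_power)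
    with m(3) \<open>\<beta> ^ k * x \<ge> T\<close> T(3) have "k < persistence 1 b ((b - 1) ^ e)"
      using assms(2) by (intro less_persistence) auto
    then have "real k \<le> persistence 1 b ((b - 1) ^ e)" by simp
    with k(2) have "ln (x / T) / l - 1 \<le> persistence 1 b ((b - 1) ^ e)" by linarith
    then show ?thesis using x x0 T(1) by (simp add: ln_div diff_divide_distrib)
  qed
  show thesis
  \<comment> \<open>The second bound on \<open>e\<close> ensures
    \<open>ln ((b - 1) ^ e) \<ge> e * ln 2 \<ge> T\<close>.\<close>
  proof (rule that[of "max N (nat \<lceil>T / ln 2\<rceil>)" "ln T / l + 1"], fold \<beta>_def, fold l_def)
    fix e assume e: "max N (nat \<lceil>T / ln 2\<rceil>) \<le> e"
    then have "T / ln 2 \<le> e" by linarith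
    then have "T \<le> e * ln 2" by (simp add: field_simps)
    also have "\<dots> \<le> e * ln (real (b - 1))" using assms(2) by (intro mult_left_mono) auto
    also have "\<dots> = ln (real ((b - 1) ^ e))" using assms(2) by (simp add: ln_realpow)
    finally show "1 / l * ln (ln (real ((b - 1) ^ e))) - (ln T / l + 1)
         \<le> real (persistence 1 b ((b - 1) ^ e))"
      using bound[OF _ refl, of e] e by simp
  qed
qed

text \<open>The powers of \<open>b - 1\<close> form a subsequence, whose limsup is at most the full
  one; the constant \<open>K\<close> vanishes after division.\<close>

lemma limsup_persistence_ge:
  assumes "conjecture_B" "b \<ge> 3"
  shows "limsup (\<lambda>n. ereal (real (persistence 1 b n) / ln (ln (real n))))
         \<ge> ereal (1 / ln (inverse (log b 2 / (2 * real b))))"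
proof -
  define C where "C = 1 / ln (inverse (log b 2 / (2 * real b)))"
  define s where "s = (\<lambda>e. (b - 1) ^ e)"
  define F where "F = (\<lambda>n. ereal (real (persistence 1 b n) / ln (ln (real n))))"
  have s: "strict_mono s"
    using assms(2) unfolding s_def by (intro strict_monoI power_strict_increasing) auto
  obtain N K where NK: "\<And>e. e \<ge> N \<Longrightarrow> real (persistence 1 b (s e)) \<ge> C * ln (ln (real (s e))) - K"
    using persistence_lower_bound[OF assms] unfolding C_def s_def by blast
  have lnln: "filterlim (\<lambda>e. ln (ln (real (s e)))) at_top sequentially"
    by (rule filterlim_compose[OF filterlim_ln_ln_sequentially filterlim_subseq[OF s]])
  have "(\<lambda>e. C - K / ln (ln (real (s e)))) \<longlonglongrightarrow> C - 0"
    by (intro tendsto_diff tendsto_const real_tendsto_divide_at_top[OF tendsto_const] lnln)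
  then have lim: "(\<lambda>e. ereal (C - K / ln (ln (real (s e))))) \<longlonglongrightarrow> ereal C" by simp
  have "\<forall>\<^sub>F e in sequentially. ln (ln (real (s e))) > 0"
    using lnln by (simp add: filterlim_at_top_dense)
  with eventually_ge_at_top[of N]
  have "\<forall>\<^sub>F e in sequentially. ereal (C - K / ln (ln (real (s e)))) \<le> (F \<circ> s) e"
  proof eventually_elim
    case (elim e)
    then have "(C * ln (ln (real (s e))) - K) / ln (ln (real (s e)))
        \<le> real (persistence 1 b (s e)) / ln (ln (real (s e)))"
      using NK[of e] by (intro divide_right_mono) auto
    with elim show ?case by (simp add: F_def diff_divide_distrib)
  qed
  then have "limsup (\<lambda>e. ereal (C - K / ln (ln (real (s e))))) \<le> limsup (F \<circ> s)"
    by (rule Limsup_mono)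
  moreover have "limsup (\<lambda>e. ereal (C - K / ln (ln (real (s e))))) = ereal C"
    by (rule lim_imp_Limsup[OF _ lim]) simp
  ultimately show ?thesis
    using limsup_subseq_mono[OF s, of F] unfolding C_def F_def by simp
qed

theorem theorem13:
  fixes b :: nat and \<alpha> \<beta> :: real
  assumes "b \<ge> 3"
    and "\<alpha> = log (real b) (real b - 1)"
    and "\<beta> = log (real b) 2 / (2 * real b)"
  shows "limsup (\<lambda>n. ereal (real (persistence 1 b n) / ln (ln (real n))))
           \<le> ereal (2 / ln (inverse \<alpha>))
    \<and> (conjecture_B \<longrightarrow>
         limsup (\<lambda>n. ereal (real (persistence 1 b n) / ln (ln (real n))))
           \<ge> ereal (1 / ln (inverse \<beta>)))"
  using limsup_persistence_le limsup_persistence_ge assms by blast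

end
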